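(* Let $t\in\mathbb{N}$ be such that $t\notin\{(s-1)s: s\in\mathbb{N}\}$, and let $\alpha(t)=\dfrac{1+\sqrt{1+4t}}{2}$. Then $\operatorname{Range}(f_{\alpha(t)})=\{m\in\mathbb{Z}: 1\le m\le\lfloor\alpha(t)\rfloor\}$.
   Context: $\mathbb{N}$ is the set of positive integers. For real $\alpha>0$, define $f_\alpha:\mathbb{N}\to\mathbb{Z}$ by $f_\alpha(n)=\lfloor\alpha^2 n\rfloor-\lfloor\alpha\lfloor\alpha n\rfloor\rfloor$, and $\operatorname{Range}(f_\alpha)=\{f_\alpha(n):n\in\mathbb{N}\}$. *)

theory Defs
  imports Complex_Main
begin

(* f_alpha; meant for alpha > 0 and n >= 1 *)
definition floor_diff :: "real \<Rightarrow> nat \<Rightarrow> int" where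
  "floor_diff \<alpha> n = \<lfloor>\<alpha>\<^sup>2 * real n\<rfloor> - \<lfloor>\<alpha> * real_of_int \<lfloor>\<alpha> * real n\<rfloor>\<rfloor>"

(* the natural numbers of the source start at 1, hence the restriction n >= 1 *)
definition floor_diff_range :: "real \<Rightarrow> int set" where
  "floor_diff_range \<alpha> = {floor_diff \<alpha> n | n. n \<ge> 1}"

definition alpha_of :: "nat \<Rightarrow> real" where
  "alpha_of t = (1 + sqrt (1 + 4 * real t)) / 2"

end

theory Submission
  imports Defs "HOL-Analysis.Kronecker_Approximation_Theorem"
begin

text \<open>
  Since \<open>\<alpha>\<^sup>2 = \<alpha> + t\<close>, the value of \<open>f\<^sub>\<alpha>\<close> at \<open>n\<close> is the ceiling of \<open>(\<alpha> - 1) \<delta>\<close>, where \<open>\<delta>\<close> is the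
  fractional part of \<open>\<alpha> n\<close>. The hypothesis on \<open>t\<close> says that \<open>\<alpha>\<close> is not an integer, hence irrational,
  so these fractional parts lie in the open unit interval and are dense there by Kronecker's theorem.
\<close>

lemma alpha_of_square: "(alpha_of t)\<^sup>2 = alpha_of t + real t"
proof -
  have "(sqrt (1 + 4 * real t))\<^sup>2 = 1 + 4 * real t"
    by simp
  then show ?thesis
    unfolding alpha_of_def by (simp add: power2_eq_square field_simps)
qed

lemma alpha_of_gt_1:
  assumes "t \<ge> 1"
  shows "alpha_of t > 1"
proof -
  have "1 < sqrt (1 + 4 * real t)"
    using assms by simp
  then show ?thesis
    unfolding alpha_of_def by simp
qed

text \<open>Rational root argument: clearing denominators in lowest terms makes \<open>b\<close>
  divide \<open>a\<^sup>2\<close>, to which it is coprime, so \<open>b\<close> is a unit.\<close>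

lemma Rats_monic_quadratic_imp_Ints:
  fixes x :: real
  assumes "x \<in> \<rat>" and root: "x\<^sup>2 = of_int p * x + of_int q"
  shows "x \<in> \<int>"
proof -
  obtain a b :: int where b: "b > 0" "coprime a b" and x: "x = of_int a / of_int b"
    using assms(1) by (meson Rats_cases')
  have "real_of_int (a\<^sup>2) = of_int (b * (p * a + q * b))"
    using root b(1) unfolding x by (simp add: field_simps power2_eq_square)
  then have "a\<^sup>2 = b * (p * a + q * b)"
    by (simp only: of_int_eq_iff)
  then have "b dvd a\<^sup>2"
    by simp
  moreover have "coprime b (a\<^sup>2)"
    using b(2) by (simp add: coprime_commute)
  ultimately have "is_unit b"
    using coprime_absorb_left by blast
  then have "b = 1"
    using b(1) by simp
  then show ?thesis
    using x by simp
qed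

lemma alpha_of_irrational:
  assumes "t \<ge> 1" and not_pronic: "t \<notin> {(s - 1) * s | s :: nat. s \<ge> 1}"
  shows "alpha_of t \<notin> \<rat>"
proof
  assume "alpha_of t \<in> \<rat>"
  then have "alpha_of t \<in> \<int>"
    using Rats_monic_quadratic_imp_Ints[of "alpha_of t" 1 "int t"] alpha_of_square[of t] by simp
  then obtain a where a: "alpha_of t = of_int a"
    by (auto elim: Ints_cases)
  have "a > 1"
    using alpha_of_gt_1[OF assms(1)] a by simp
  define s where "s = nat a"
  have s: "alpha_of t = real s" "s \<ge> 1"
    using a \<open>a > 1\<close> by (auto simp: s_def)
  \<comment> \<open>\<open>alpha_of_square\<close> reads s^2 = s + t. Since
    \<open>s \<ge> 1\<close>, the natural subtraction \<open>s - 1\<close> does not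
    truncate.\<close>
  have "real t = real ((s - 1) * s)"
    using alpha_of_square[of t] s by (simp add: of_nat_diff power2_eq_square algebra_simps)
  then have "t = (s - 1) * s"
    by (simp only: of_nat_eq_iff)
  then show False
    using not_pronic s(2) by blast
qed

text \<open>Both floors contain the integer \<open>k + int (t * n)\<close>, which cancels. What
  remains is the negated floor of \<open>- ((\<alpha> - 1) * \<delta>)\<close>, that is, a
  ceiling.\<close>

lemma floor_diff_eq_ceiling_frac:
  assumes square: "\<alpha>\<^sup>2 = \<alpha> + real t"
  shows "floor_diff \<alpha> n = \<lceil>(\<alpha> - 1) * frac (real n * \<alpha>)\<rceil>"
proof -
  define k where "k = \<lfloor>\<alpha> * real n\<rfloor>"
  define \<delta> where "\<delta> = frac (real n * \<alpha>)"
  have k: "of_int k = \<alpha> * real n - \<delta>"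
    by (simp add: k_def \<delta>_def frac_def mult.commute)
  have "\<alpha>\<^sup>2 * real n = \<alpha> * real n + of_int (int (t * n))"
    unfolding square by (simp add: algebra_simps)
  then have floor1: "\<lfloor>\<alpha>\<^sup>2 * real n\<rfloor> = k + int (t * n)"
    unfolding k_def by (metis floor_add_int)
  have "\<alpha> * of_int k = \<alpha>\<^sup>2 * real n - \<alpha> * \<delta>"
    unfolding k by (simp add: power2_eq_square algebra_simps)
  \<comment> \<open>Replacing \<open>\<alpha> * real n\<close> by k + \<delta> gives back one
    \<delta>, hence the factor \<open>\<alpha> - 1\<close>.\<close>
  also have "\<dots> = - ((\<alpha> - 1) * \<delta>) + of_int (k + int (t * n))"
    unfolding square using k by (simp add: algebra_simps)
  finally have "\<lfloor>\<alpha> * of_int k\<rfloor> = \<lfloor>- ((\<alpha> - 1) * \<delta>)\<rfloor> + (k + int (t * n))"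
    by (metis floor_add_int)
  then show ?thesis
    unfolding floor_diff_def floor1 k_def[symmetric] \<delta>_def[symmetric] by (simp add: ceiling_def)
qed

theorem proposition4p1:
  fixes t :: nat
  assumes "t \<ge> 1"
    and "t \<notin> {(s - 1) * s | s :: nat. s \<ge> 1}"
  shows "floor_diff_range (alpha_of t) = {m :: int. 1 \<le> m \<and> m \<le> \<lfloor>alpha_of t\<rfloor>}"
proof -
  define \<alpha> where "\<alpha> = alpha_of t"
  have gt1: "\<alpha> > 1" and irrational: "\<alpha> \<notin> \<rat>"
    using alpha_of_gt_1 alpha_of_irrational assms unfolding \<alpha>_def by blast+
  have floor_diff: "floor_diff \<alpha> n = \<lceil>(\<alpha> - 1) * frac (real n * \<alpha>)\<rceil>" for n
    unfolding \<alpha>_def by (rule floor_diff_eq_ceiling_frac[OF alpha_of_square])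
  have "1 \<le> floor_diff \<alpha> n \<and> floor_diff \<alpha> n \<le> \<lfloor>\<alpha>\<rfloor>" if "n \<ge> 1" for n
  proof -
    \<comment> \<open>A nonzero fractional part makes the ceiling at least 1.\<close>
    have "real n * \<alpha> \<notin> \<int>"
    proof
      assume "real n * \<alpha> \<in> \<int>"
      then have "real n * \<alpha> / real n \<in> \<rat>"
        by (intro Rats_divide Rats_of_nat) (use Ints_subset_Rats in blast)
      then show False
        using irrational that by simp
    qed
    then have pos: "0 < (\<alpha> - 1) * frac (real n * \<alpha>)"
      using gt1 by (simp add: frac_gt_0_iff)
    have "(\<alpha> - 1) * frac (real n * \<alpha>) \<le> \<alpha> - 1"
      using gt1 frac_lt_1[of "real n * \<alpha>"] by (simp add: mult_left_le less_imp_le)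
    also have "\<dots> \<le> of_int \<lfloor>\<alpha>\<rfloor>"
      by linarith
    finally show ?thesis
      using pos unfolding floor_diff by (simp add: ceiling_le_iff)
  qed
  moreover have "\<exists>n\<ge>1. floor_diff \<alpha> n = m" if m: "1 \<le> m" "m \<le> \<lfloor>\<alpha>\<rfloor>" for m
  proof -
    \<comment> \<open>The ceiling of (\<alpha> - 1) x equals m as soon as x lies strictly between
      \<open>l\<close> and \<open>u\<close>; the cap at 1 keeps the target inside the unit
      interval.\<close>
    define l where "l = (of_int m - 1) / (\<alpha> - 1)"
    define u where "u = min 1 (of_int m / (\<alpha> - 1))"
    \<comment> \<open>Strictness of m < \<alpha> yields \<open>l\<close> < 1, so the interval is
      nonempty even for m = \<open>\<lfloor>\<alpha>\<rfloor>\<close>.\<close>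
    have "of_int m \<noteq> \<alpha>"
      using irrational by auto
    then have "of_int m < \<alpha>"
      using m(2) by (simp add: le_floor_iff)
    then have lu: "0 \<le> l" "l < u" "u \<le> 1"
      using m(1) gt1 by (auto simp: l_def u_def divide_simps)
    \<comment> \<open>Approximating the midpoint to within half the length places the fractional
      part in the open interval.\<close>
    obtain k where k: "k > 0" "\<bar>frac (real k * \<alpha>) - (l + u) / 2\<bar> < (u - l) / 2"
      using Kronecker_approx_1_explicit[OF irrational, of "(l + u) / 2" "(u - l) / 2"] lu by auto
    then have "l < frac (real k * \<alpha>)" "frac (real k * \<alpha>) < u"
      by (auto simp: abs_less_iff field_simps)
    then have "l < frac (real k * \<alpha>)" "frac (real k * \<alpha>) < of_int m / (\<alpha> - 1)"
      by (auto simp: u_def)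
    then have "of_int m - 1 < (\<alpha> - 1) * frac (real k * \<alpha>)" "(\<alpha> - 1) * frac (real k * \<alpha>) \<le> of_int m"
      using gt1 by (auto simp: l_def field_simps)
    then have "floor_diff \<alpha> k = m"
      unfolding floor_diff by (simp add: ceiling_eq_iff)
    then show ?thesis
      using k(1) by (auto intro: exI[of _ k])
  qed
  ultimately show ?thesis
    unfolding floor_diff_range_def \<alpha>_def[symmetric] by blast
qed

end
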